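(* For each positive integer $r$, the following hold. (i) $C_2 \circ \overline{K}_{4r^2-1}$ has perfect state transfer between the (two) vertices of $C_2$ at time $\pi/2$; that is, if $u,v$ are the vertices of $C_2$, there is perfect state transfer between $(u,0)$ and $(v,0)$ at time $\pi/2$. (ii) $C_4 \circ \overline{K}_{4r^2-1}$ has real perfect state transfer between the two antipodal pairs of vertices of $C_4$ at time $\pi/2$; that is, if $\{u_1,u_2\}$ and $\{v_1,v_2\}$ are the two pairs of antipodal vertices of the $4$-cycle $C_4$, there is real perfect state transfer between $\{(u_1,0),(u_2,0)\}$ and $\{(v_1,0),(v_2,0)\}$ at time $\pi/2$.
   Context: $C_2$ is the digon: the multigraph on two vertices joined by two parallel edges, with adjacency matrix $\begin{pmatrix}0&2\\2&0\end{pmatrix}$. $C_4$ is the cycle on $4$ vertices and $\overline{K}_m$ is the edgeless graph on $m$ vertices. For a (multi)graph $G$ on $n$ vertices and a graph $H$ on $m$ vertices, the corona $G\circ H$ has vertex set $V(G)\times(\{0\}\cup V(H))$ (where $0\notin V(H)$) and is obtained by placing a copy of $G$ on the vertices $(v,0)$, a copy of $H$ on $\{v\}\times V(H)$ for each $v\in V(G)$, and joining $(v,0)$ to every vertex of $\{v\}\times V(H)$ by a single edge. Its adjacency matrix is $A(G\circ H)=A(G)\otimes e_0e_0^T+I_n\otimes\begin{pmatrix}0&j_m^T\\ j_m&A(H)\end{pmatrix}$, where $j_m$ is the all-ones vector and $e_0$ the standard basis vector indexed by $0$. Let $e_u$ be the standard basis vector of vertex $u$. There is perfect state transfer between vertices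 $u,v$ of $X$ at time $\tau$ if $|e_v^Te^{-\mathrm{i}\tau A(X)}e_u|=1$. For a set $U$ of vertices, let $e_U=|U|^{-1/2}\sum_{v\in U}e_v$; there is real perfect state transfer between vertex subsets $U_1,U_2$ at time $\tau$ if $|e_{U_1}^Te^{-\mathrm{i}\tau A(X)}e_{U_2}|=1$. *)

theory Defs
  imports Complex_Main "Jordan_Normal_Form.Matrix"
begin

text \<open>
  A finite undirected multigraph is given by a list of pairwise distinct vertices and the
  symmetric function counting the edges between two vertices.  The order of the list only
  fixes the numbering of the rows and columns of the adjacency matrix.  Edge counts at
  arguments outside the list are irrelevant.
\<close>

record 'a mgraph =
  verts :: "'a list"
  edge_count :: "'a \<Rightarrow> 'a \<Rightarrow> nat"

definition digon :: "nat mgraph" where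
  "digon = \<lparr> verts = [0, 1], edge_count = (\<lambda>u v. if u \<noteq> v then 2 else 0) \<rparr>"

text \<open>The cycle on \<open>n \<ge> 3\<close> vertices.\<close>

definition cycle_graph :: "nat \<Rightarrow> nat mgraph" where
  "cycle_graph n = \<lparr> verts = [0..<n],
     edge_count = (\<lambda>u v. if v = (u + 1) mod n \<or> u = (v + 1) mod n then 1 else 0) \<rparr>"

text \<open>Antipodal vertices of the cycle on \<open>n\<close> vertices, for even \<open>n\<close>.\<close>

definition antipodal_in_cycle :: "nat \<Rightarrow> nat \<Rightarrow> nat \<Rightarrow> bool" where
  "antipodal_in_cycle n u v \<longleftrightarrow>
     u \<in> set (verts (cycle_graph n)) \<and> v = (u + n div 2) mod n"

definition edgeless_graph :: "nat \<Rightarrow> nat mgraph" where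
  "edgeless_graph m = \<lparr> verts = [0..<m], edge_count = (\<lambda>u v. 0) \<rparr>"

text \<open>
  In the corona, \<^const>\<open>None\<close> plays the role of the extra index \<open>0 \<notin> V(H)\<close>, so the
  vertex \<open>(v, 0)\<close> is \<open>(v, None)\<close> and \<open>(v, x)\<close> with \<open>x \<in> V(H)\<close> is \<open>(v, Some x)\<close>.
\<close>

fun corona_count :: "'a mgraph \<Rightarrow> 'b mgraph \<Rightarrow> 'a \<times> 'b option \<Rightarrow> 'a \<times> 'b option \<Rightarrow> nat" where
  "corona_count G H (v, None) (w, None) = edge_count G v w"
| "corona_count G H (v, None) (w, Some y) = (if v = w then 1 else 0)"
| "corona_count G H (v, Some x) (w, None) = (if v = w then 1 else 0)"
| "corona_count G H (v, Some x) (w, Some y) = (if v = w then edge_count H x y else 0)"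

definition corona :: "'a mgraph \<Rightarrow> 'b mgraph \<Rightarrow> ('a \<times> 'b option) mgraph" where
  "corona G H = \<lparr> verts = List.product (verts G) (None # map Some (verts H)),
                  edge_count = corona_count G H \<rparr>"

definition adjacency_mat :: "'a mgraph \<Rightarrow> complex mat" where
  "adjacency_mat X = mat (length (verts X)) (length (verts X))
     (\<lambda>(i, j). of_nat (edge_count X (verts X ! i) (verts X ! j)))"

text \<open>The exponential series of a square matrix, taken entrywise.\<close>

definition mat_exp :: "complex mat \<Rightarrow> complex mat" where
  "mat_exp A = mat (dim_row A) (dim_row A) (\<lambda>(i, j). \<Sum>k. (A ^\<^sub>m k) $$ (i, j) / fact k)"

definition transition_mat :: "'a mgraph \<Rightarrow> real \<Rightarrow> complex mat" where
  "transition_mat X \<tau> = mat_exp ((- \<i> * complex_of_real \<tau>) \<cdot>\<^sub>m adjacency_mat X)"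

definition vertex_vec :: "'a mgraph \<Rightarrow> 'a \<Rightarrow> complex vec" where
  "vertex_vec X u = vec (length (verts X)) (\<lambda>i. if verts X ! i = u then 1 else 0)"

definition vertex_set_vec :: "'a mgraph \<Rightarrow> 'a set \<Rightarrow> complex vec" where
  "vertex_set_vec X U =
     complex_of_real (1 / sqrt (real (card U))) \<cdot>\<^sub>v
       vec (length (verts X)) (\<lambda>i. if verts X ! i \<in> U then 1 else 0)"

text \<open>
  The scalar product below is the bilinear one, so it is the product of a transposed
  (not conjugate transposed) vector with a vector.
\<close>

definition perfect_state_transfer :: "'a mgraph \<Rightarrow> real \<Rightarrow> 'a \<Rightarrow> 'a \<Rightarrow> bool" where
  "perfect_state_transfer X \<tau> u v \<longleftrightarrow>
     cmod (vertex_vec X v \<bullet> (transition_mat X \<tau> *\<^sub>v vertex_vec X u)) = 1"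

definition real_perfect_state_transfer :: "'a mgraph \<Rightarrow> real \<Rightarrow> 'a set \<Rightarrow> 'a set \<Rightarrow> bool" where
  "real_perfect_state_transfer X \<tau> U\<^sub>1 U\<^sub>2 \<longleftrightarrow>
     cmod (vertex_set_vec X U\<^sub>1 \<bullet> (transition_mat X \<tau> *\<^sub>v vertex_set_vec X U\<^sub>2)) = 1"

end

theory Submission imports Defs begin

text \<open>
  Let \<open>m = 4r\<^sup>2 - 1\<close>.  If \<open>g\<close> is an eigenfunction of the multigraph \<open>G\<close> with eigenvalue \<open>2s\<close>,
  \<open>s = \<plusminus>1\<close>, then the functions on \<open>G \<circ> K\<close>, where \<open>K\<close> is the edgeless graph on \<open>m\<close> vertices, that
  equal \<open>\<theta> g(v)\<close> at \<open>(v, 0)\<close> and \<open>g(v)\<close> at the pendant vertices \<open>(v, x)\<close> are eigenfunctions with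
  eigenvalue \<open>\<theta>\<close> whenever \<open>\<theta>\<^sup>2 - 2s\<theta> - m = 0\<close>.  As \<open>1 + m = (2r)\<^sup>2\<close>, the two roots are
  \<open>s + 2r\<close> and \<open>s - 2r\<close>.  They differ by \<open>4r\<close>, so at time \<open>\<pi>/2\<close> both eigenfunctions acquire
  the same phase \<open>exp (-\<i>\<pi>\<theta>/2) = (-1)\<^sup>r (-\<i>s)\<close>, and so does their difference, which is \<open>4r\<close> times
  the extension of \<open>g\<close> by \<open>0\<close> (lemma \<open>corona_eigenfunction_transition\<close>).

  Suppose now that the adjacency operator of \<open>G\<close> maps \<open>f\<close> to \<open>2h\<close> and \<open>h\<close> to \<open>2f\<close>.  Then
  \<open>f + h\<close> and \<open>f - h\<close> are eigenfunctions with eigenvalues \<open>2\<close> and \<open>-2\<close>, whose phases are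
  opposite, so \<open>f\<close> is carried to \<open>h\<close> up to a factor of modulus \<open>1\<close> (lemma
  \<open>corona_swap_transition\<close>).  For the digon this applies to the indicators of the two vertices,
  for the \<open>4\<close>-cycle to the indicators of the two antipodal pairs.
\<close>

section \<open>The matrix exponential on eigenvectors\<close>

lemma pow_mat_entry_bound:
  fixes A :: "complex mat"
  assumes A: "A \<in> carrier_mat n n"
    and b: "\<And>i j. i < n \<Longrightarrow> j < n \<Longrightarrow> cmod (A $$ (i, j)) \<le> b"
    and ij: "i < n" "j < n"
  shows "cmod ((A ^\<^sub>m k) $$ (i, j)) \<le> (real n * b) ^ k"
  using ij
proof (induction k arbitrary: i j)
  case 0
  then show ?case using A by auto
next
  case (Suc k)
  have b0: "0 \<le> b" using b[OF Suc.prems] norm_ge_zero order_trans by blast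
  have P: "A ^\<^sub>m k \<in> carrier_mat n n" using A by simp
  have "(A ^\<^sub>m Suc k) $$ (i, j) = (\<Sum>l = 0..<n. (A ^\<^sub>m k) $$ (i, l) * A $$ (l, j))"
    using A P Suc.prems by (simp add: scalar_prod_def)
  also have "cmod \<dots> \<le> (\<Sum>l = 0..<n. (real n * b) ^ k * b)"
  proof (rule sum_norm_le)
    fix l assume "l \<in> {0..<n}"
    then have "cmod ((A ^\<^sub>m k) $$ (i, l)) \<le> (real n * b) ^ k" "cmod (A $$ (l, j)) \<le> b"
      using Suc.IH Suc.prems b by simp_all
    then show "cmod ((A ^\<^sub>m k) $$ (i, l) * A $$ (l, j)) \<le> (real n * b) ^ k * b"
      unfolding norm_mult by (rule mult_mono) (simp_all add: b0)
  qed
  finally show ?case by (simp add: mult_ac)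
qed

lemma summable_mat_exp_entry:
  fixes A :: "complex mat"
  assumes A: "A \<in> carrier_mat n n" and ij: "i < n" "j < n"
  shows "summable (\<lambda>k. (A ^\<^sub>m k) $$ (i, j) / fact k)"
proof -
  define b where "b = (\<Sum>i<n. \<Sum>j<n. cmod (A $$ (i, j)))"
  have b: "cmod (A $$ (i, j)) \<le> b" if "i < n" "j < n" for i j
  proof -
    have "cmod (A $$ (i, j)) \<le> (\<Sum>j<n. cmod (A $$ (i, j)))"
      using that by (intro member_le_sum) auto
    also have "\<dots> \<le> b"
      unfolding b_def using that by (intro member_le_sum) (auto intro: sum_nonneg)
    finally show ?thesis .
  qed
  show ?thesis
  proof (rule summable_comparison_test')
    show "summable (\<lambda>k. inverse (fact k) * (real n * b) ^ k)"
      by (rule summable_exp)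
    show "norm ((A ^\<^sub>m k) $$ (i, j) / fact k) \<le> inverse (fact k) * (real n * b) ^ k" for k
      using pow_mat_entry_bound[OF A b ij, of k]
      by (simp add: norm_divide divide_simps mult.commute)
  qed
qed

lemma pow_mat_mult_eigenvec:
  fixes A :: "'a :: field mat"
  assumes A: "A \<in> carrier_mat n n" and w: "w \<in> carrier_vec n" and ev: "A *\<^sub>v w = \<theta> \<cdot>\<^sub>v w"
  shows "(A ^\<^sub>m k) *\<^sub>v w = \<theta> ^ k \<cdot>\<^sub>v w"
proof (induction k)
  case 0
  then show ?case using A w by simp
next
  case (Suc k)
  have P: "A ^\<^sub>m k \<in> carrier_mat n n" using A by simp
  have "(A ^\<^sub>m Suc k) *\<^sub>v w = A ^\<^sub>m k *\<^sub>v (\<theta> \<cdot>\<^sub>v w)"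
    using A w P ev by (simp add: assoc_mult_mat_vec[OF P A w])
  also have "\<dots> = \<theta> \<cdot>\<^sub>v (A ^\<^sub>m k *\<^sub>v w)"
    by (rule mult_mat_vec[OF P w])
  finally show ?case by (simp add: Suc smult_smult_assoc)
qed

lemma mat_exp_carrier: "A \<in> carrier_mat n n \<Longrightarrow> mat_exp A \<in> carrier_mat n n"
  by (simp add: mat_exp_def)

lemma mat_exp_mult_eigenvec:
  assumes A: "A \<in> carrier_mat n n" and w: "w \<in> carrier_vec n" and ev: "A *\<^sub>v w = \<theta> \<cdot>\<^sub>v w"
  shows "mat_exp A *\<^sub>v w = exp \<theta> \<cdot>\<^sub>v w"
proof (rule eq_vecI)
  fix i assume "i < dim_vec (exp \<theta> \<cdot>\<^sub>v w)"
  then have i: "i < n" using w by simp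
  have "(mat_exp A *\<^sub>v w) $ i = (\<Sum>j<n. (\<Sum>k. (A ^\<^sub>m k) $$ (i, j) / fact k) * w $ j)"
    using A w i by (simp add: mat_exp_def scalar_prod_def lessThan_atLeast0)
  also have "\<dots> = (\<Sum>j<n. \<Sum>k. (A ^\<^sub>m k) $$ (i, j) / fact k * w $ j)"
    using summable_mat_exp_entry[OF A i] by (intro sum.cong) (auto simp: suminf_mult2)
  also have "\<dots> = (\<Sum>k. \<Sum>j<n. (A ^\<^sub>m k) $$ (i, j) / fact k * w $ j)"
    using summable_mat_exp_entry[OF A i] by (intro suminf_sum[symmetric] summable_mult2) auto
  also have "\<dots> = (\<Sum>k. \<theta> ^ k /\<^sub>R fact k * w $ i)"
  proof (rule suminf_cong)
    fix k
    have "(\<Sum>j<n. (A ^\<^sub>m k) $$ (i, j) / fact k * w $ j) = (A ^\<^sub>m k *\<^sub>v w) $ i / fact k"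
      using A w i by (simp add: scalar_prod_def lessThan_atLeast0 sum_divide_distrib)
    also have "\<dots> = \<theta> ^ k /\<^sub>R fact k * w $ i"
      using w i by (simp add: pow_mat_mult_eigenvec[OF A w ev] scaleR_conv_of_real divide_inverse)
    finally show "(\<Sum>j<n. (A ^\<^sub>m k) $$ (i, j) / fact k * w $ j) = \<theta> ^ k /\<^sub>R fact k * w $ i" .
  qed
  also have "\<dots> = exp \<theta> * w $ i"
    unfolding exp_def by (rule suminf_mult2[symmetric]) (rule summable_exp_generic)
  finally show "(mat_exp A *\<^sub>v w) $ i = (exp \<theta> \<cdot>\<^sub>v w) $ i" using w i by simp
qed (use A w in \<open>simp add: mat_exp_def\<close>)

section \<open>Functions on the vertices of a multigraph\<close>

text \<open>The coordinate vector of a function on the vertices, in the order of the vertex list.\<close>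

definition fun_vec :: "'a mgraph \<Rightarrow> ('a \<Rightarrow> complex) \<Rightarrow> complex vec" where
  "fun_vec X f = vec (length (verts X)) (\<lambda>i. f (verts X ! i))"

text \<open>The adjacency operator on functions.  It agrees with the adjacency matrix when the vertex
  list has no repetitions.\<close>

definition adj_op :: "'a mgraph \<Rightarrow> ('a \<Rightarrow> complex) \<Rightarrow> 'a \<Rightarrow> complex" where
  "adj_op X f x = (\<Sum>y\<in>set (verts X). of_nat (edge_count X x y) * f y)"

lemma fun_vec_carrier: "fun_vec X f \<in> carrier_vec (length (verts X))"
  by (simp add: fun_vec_def)

lemma fun_vec_cong: "(\<And>x. x \<in> set (verts X) \<Longrightarrow> f x = g x) \<Longrightarrow> fun_vec X f = fun_vec X g"
  by (auto simp: fun_vec_def)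

lemma fun_vec_smult: "c \<cdot>\<^sub>v fun_vec X f = fun_vec X (\<lambda>x. c * f x)"
  by (auto simp: fun_vec_def)

lemma fun_vec_add: "fun_vec X f + fun_vec X g = fun_vec X (\<lambda>x. f x + g x)"
  by (auto simp: fun_vec_def)

lemma sum_distinct_nth:
  assumes "distinct xs"
  shows "(\<Sum>i = 0..<length xs. f (xs ! i)) = sum f (set xs)"
proof -
  have "bij_betw ((!) xs) {0..<length xs} (set xs)"
    using assms by (intro bij_betw_nth) auto
  then show ?thesis by (rule sum.reindex_bij_betw)
qed

lemma scalar_prod_fun_vec:
  assumes "distinct (verts X)"
  shows "fun_vec X f \<bullet> fun_vec X g = (\<Sum>x\<in>set (verts X). f x * g x)"
  using sum_distinct_nth[OF assms, of "\<lambda>x. f x * g x"]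
  by (simp add: fun_vec_def scalar_prod_def)

lemma adjacency_mat_carrier:
  "adjacency_mat X \<in> carrier_mat (length (verts X)) (length (verts X))"
  by (simp add: adjacency_mat_def)

lemma transition_mat_carrier:
  "transition_mat X \<tau> \<in> carrier_mat (length (verts X)) (length (verts X))"
  by (simp add: transition_mat_def mat_exp_carrier adjacency_mat_carrier)

lemma adjacency_mat_mult_fun_vec:
  assumes "distinct (verts X)"
  shows "adjacency_mat X *\<^sub>v fun_vec X f = fun_vec X (adj_op X f)"
proof (rule eq_vecI)
  fix i assume "i < dim_vec (fun_vec X (adj_op X f))"
  then have i: "i < length (verts X)" by (simp add: fun_vec_def)
  then show "(adjacency_mat X *\<^sub>v fun_vec X f) $ i = fun_vec X (adj_op X f) $ i"
    using sum_distinct_nth[OF assms, of "\<lambda>y. of_nat (edge_count X (verts X ! i) y) * f y"]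
    by (simp add: adjacency_mat_def fun_vec_def scalar_prod_def adj_op_def)
qed (simp add: adjacency_mat_def fun_vec_def)

lemma transition_mat_mult_eigenfunction:
  assumes dist: "distinct (verts X)"
    and ev: "\<And>x. x \<in> set (verts X) \<Longrightarrow> adj_op X f x = \<theta> * f x"
  shows "transition_mat X \<tau> *\<^sub>v fun_vec X f = exp (- \<i> * of_real \<tau> * \<theta>) \<cdot>\<^sub>v fun_vec X f"
  unfolding transition_mat_def
proof (rule mat_exp_mult_eigenvec[OF _ fun_vec_carrier])
  let ?c = "- \<i> * complex_of_real \<tau>"
  show "?c \<cdot>\<^sub>m adjacency_mat X \<in> carrier_mat (length (verts X)) (length (verts X))"
    by (rule smult_carrier_mat) (rule adjacency_mat_carrier)
  have "(?c \<cdot>\<^sub>m adjacency_mat X) *\<^sub>v fun_vec X f = ?c \<cdot>\<^sub>v (adjacency_mat X *\<^sub>v fun_vec X f)"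
    by (rule eq_vecI)
      (simp_all add: adjacency_mat_def fun_vec_def scalar_prod_def sum_distrib_left mult.assoc)
  also have "adjacency_mat X *\<^sub>v fun_vec X f = \<theta> \<cdot>\<^sub>v fun_vec X f"
    unfolding adjacency_mat_mult_fun_vec[OF dist] fun_vec_smult
    using ev by (rule fun_vec_cong)
  finally show "(?c \<cdot>\<^sub>m adjacency_mat X) *\<^sub>v fun_vec X f = (?c * \<theta>) \<cdot>\<^sub>v fun_vec X f"
    by (simp add: smult_smult_assoc)
qed

section \<open>Coronas with edgeless graphs\<close>

lemma verts_corona: "set (verts (corona G H)) = set (verts G) \<times> insert None (Some ` set (verts H))"
  by (simp add: corona_def)

lemma distinct_verts_corona:
  "distinct (verts G) \<Longrightarrow> distinct (verts H) \<Longrightarrow> distinct (verts (corona G H))"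
  by (auto simp: corona_def distinct_map intro!: distinct_product)

text \<open>The extension by \<open>0\<close> of a function on \<open>G\<close> to the corona.\<close>

definition corona_ext :: "('a \<Rightarrow> complex) \<Rightarrow> 'a \<times> 'b option \<Rightarrow> complex" where
  "corona_ext g = (\<lambda>(v, z). if z = None then g v else 0)"

text \<open>The function with value \<open>\<theta> g(v)\<close> at \<open>(v, 0)\<close> and \<open>g(v)\<close> at the other \<open>(v, x)\<close>.\<close>

definition corona_lift :: "complex \<Rightarrow> ('a \<Rightarrow> complex) \<Rightarrow> 'a \<times> 'b option \<Rightarrow> complex" where
  "corona_lift \<theta> g = (\<lambda>(v, z). if z = None then \<theta> * g v else g v)"

lemma sum_corona_ext:
  "(\<Sum>x\<in>set (verts (corona G H)). corona_ext f x) = (\<Sum>v\<in>set (verts G). f v)"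
proof -
  have "(\<Sum>x\<in>set (verts (corona G H)). corona_ext f x)
      = (\<Sum>v\<in>set (verts G). \<Sum>z\<in>insert None (Some ` set (verts H)). corona_ext f (v, z))"
    by (simp add: verts_corona sum.cartesian_product del: sum.insert)
  also have "\<dots> = (\<Sum>v\<in>set (verts G). f v)"
  proof (rule sum.cong[OF refl])
    fix v
    have "(\<Sum>z\<in>Some ` set (verts H). corona_ext f (v, z)) = 0"
      by (rule sum.neutral) (auto simp: corona_ext_def)
    then show "(\<Sum>z\<in>insert None (Some ` set (verts H)). corona_ext f (v, z)) = f v"
      by (simp add: corona_ext_def image_iff)
  qed
  finally show ?thesis .
qed

text \<open>
  The condition on \<open>\<theta>\<close> comes from the equation at \<open>(v, 0)\<close>; at a pendant vertex, whose only
  neighbour is \<open>(v, 0)\<close>, the eigenvalue equation holds for every \<open>\<theta>\<close>.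
\<close>

lemma adj_op_corona_lift:
  assumes ev: "\<And>v. v \<in> set (verts G) \<Longrightarrow> adj_op G g v = \<mu> * g v"
    and \<theta>: "\<theta>\<^sup>2 = \<mu> * \<theta> + of_nat m"
    and x: "x \<in> set (verts (corona G (edgeless_graph m)))"
  shows "adj_op (corona G (edgeless_graph m)) (corona_lift \<theta> g) x = \<theta> * corona_lift \<theta> g x"
proof -
  obtain v z where vz: "x = (v, z)" by (cases x)
  have v: "v \<in> set (verts G)" using x by (simp add: vz verts_corona)
  let ?C = "corona G (edgeless_graph m)"
  let ?c = "corona_count G (edgeless_graph m)"
  have "adj_op ?C (corona_lift \<theta> g) x
     = (\<Sum>w\<in>set (verts G). \<Sum>y\<in>insert None (Some ` {0..<m}). of_nat (?c x (w, y)) * corona_lift \<theta> g (w, y))"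
    by (simp add: adj_op_def corona_def edgeless_graph_def sum.cartesian_product del: sum.insert)
  also have "\<dots> = (\<Sum>w\<in>set (verts G). of_nat (?c x (w, None)) * (\<theta> * g w)
        + (\<Sum>y\<in>{0..<m}. of_nat (?c x (w, Some y)) * g w))"
    by (intro sum.cong refl, subst sum.insert) (auto simp: corona_lift_def sum.reindex)
  also have "\<dots> = \<theta> * corona_lift \<theta> g x"
  proof (cases z)
    case None
    have "(\<Sum>w\<in>set (verts G). of_nat (?c x (w, None)) * (\<theta> * g w)
        + (\<Sum>y\<in>{0..<m}. of_nat (?c x (w, Some y)) * g w))
       = \<theta> * adj_op G g v + (\<Sum>w\<in>set (verts G). if v = w then of_nat m * g w else 0)"
      unfolding adj_op_def sum_distrib_left sum.distrib[symmetric]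
      by (rule sum.cong) (auto simp: vz None)
    also have "\<dots> = (\<mu> * \<theta> + of_nat m) * g v"
      using v by (simp add: ev algebra_simps)
    finally show ?thesis
      by (simp add: \<theta>[symmetric] corona_lift_def vz None power2_eq_square)
  next
    case (Some a)
    have "(\<Sum>w\<in>set (verts G). of_nat (?c x (w, None)) * (\<theta> * g w)
        + (\<Sum>y\<in>{0..<m}. of_nat (?c x (w, Some y)) * g w))
       = (\<Sum>w\<in>set (verts G). if v = w then \<theta> * g w else 0)"
      by (rule sum.cong) (auto simp: vz Some edgeless_graph_def)
    then show ?thesis using v by (simp add: vz Some corona_lift_def)
  qed
  finally show ?thesis .
qed

section \<open>Transition at time \<open>\<pi>/2\<close>\<close>

lemma phase_shift:
  "exp (- \<i> * of_real (pi / 2) * (s + 2 * of_nat r))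
    = (-1) ^ r * exp (- \<i> * of_real (pi / 2) * s)"
  "exp (- \<i> * of_real (pi / 2) * (s - 2 * of_nat r))
    = (-1) ^ r * exp (- \<i> * of_real (pi / 2) * s)"
proof -
  have p: "exp (of_nat r * (\<i> * of_real pi)) = (-1) ^ r"
    unfolding exp_of_nat_mult by simp
  have "exp (- (\<i> * of_real pi)) = (-1 :: complex)"
    by (simp add: exp_minus)
  then have q: "exp (of_nat r * (- (\<i> * of_real pi))) = (-1) ^ r"
    unfolding exp_of_nat_mult by simp
  show "exp (- \<i> * of_real (pi / 2) * (s + 2 * of_nat r))
    = (-1) ^ r * exp (- \<i> * of_real (pi / 2) * s)"
    unfolding q[symmetric] exp_add[symmetric] by (rule arg_cong[of _ _ exp]) (simp add: field_simps)
  show "exp (- \<i> * of_real (pi / 2) * (s - 2 * of_nat r))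
    = (-1) ^ r * exp (- \<i> * of_real (pi / 2) * s)"
    unfolding p[symmetric] exp_add[symmetric] by (rule arg_cong[of _ _ exp]) (simp add: field_simps)
qed

text \<open>
  The two eigenvalues \<open>s \<plusminus> 2r\<close> above the eigenvalue \<open>2s\<close> of \<open>G\<close> differ by a multiple of \<open>4\<close>,
  hence have the same phase at time \<open>\<pi>/2\<close>.
\<close>

lemma corona_eigenfunction_transition:
  assumes dist: "distinct (verts G)" and r: "r > 0"
    and ev: "\<And>v. v \<in> set (verts G) \<Longrightarrow> adj_op G g v = 2 * s * g v"
    and s: "s\<^sup>2 + of_nat m = (2 * of_nat r)\<^sup>2"
  shows "transition_mat (corona G (edgeless_graph m)) (pi / 2)
           *\<^sub>v fun_vec (corona G (edgeless_graph m)) (corona_ext g)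
       = ((-1) ^ r * exp (- \<i> * of_real (pi / 2) * s))
           \<cdot>\<^sub>v fun_vec (corona G (edgeless_graph m)) (corona_ext g)"
proof -
  let ?X = "corona G (edgeless_graph m)"
  let ?U = "transition_mat ?X (pi / 2)"
  let ?p = "(-1) ^ r * exp (- \<i> * of_real (pi / 2) * s)"
  let ?F = "\<lambda>\<theta>. fun_vec ?X (corona_lift \<theta> g)"
  let ?\<theta> = "s + 2 * of_nat r" and ?\<eta> = "s - 2 * of_nat r"
  let ?c = "1 / (4 * of_nat r) :: complex"
  have distX: "distinct (verts ?X)"
    using dist by (intro distinct_verts_corona) (simp_all add: edgeless_graph_def)
  have m: "of_nat m = (2 * of_nat r)\<^sup>2 - s\<^sup>2" using s by (simp add: algebra_simps)
  have "?U *\<^sub>v ?F ?\<theta> = exp (- \<i> * of_real (pi / 2) * ?\<theta>) \<cdot>\<^sub>v ?F ?\<theta>"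
  proof (rule transition_mat_mult_eigenfunction[OF distX adj_op_corona_lift[OF ev]])
    show "?\<theta>\<^sup>2 = 2 * s * ?\<theta> + of_nat m" unfolding m by (simp add: power2_eq_square algebra_simps)
  qed
  then have plus: "?U *\<^sub>v ?F ?\<theta> = ?p \<cdot>\<^sub>v ?F ?\<theta>" unfolding phase_shift .
  have "?U *\<^sub>v ?F ?\<eta> = exp (- \<i> * of_real (pi / 2) * ?\<eta>) \<cdot>\<^sub>v ?F ?\<eta>"
  proof (rule transition_mat_mult_eigenfunction[OF distX adj_op_corona_lift[OF ev]])
    show "?\<eta>\<^sup>2 = 2 * s * ?\<eta> + of_nat m" unfolding m by (simp add: power2_eq_square algebra_simps)
  qed
  then have minus: "?U *\<^sub>v ?F ?\<eta> = ?p \<cdot>\<^sub>v ?F ?\<eta>" unfolding phase_shift .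
  \<comment> \<open>The lifts agree off \<open>V(G) \<times> {0}\<close>, where their difference is therefore \<open>0\<close>.\<close>
  have ext: "fun_vec ?X (corona_ext g) = ?c \<cdot>\<^sub>v ?F ?\<theta> + (- ?c) \<cdot>\<^sub>v ?F ?\<eta>"
    unfolding fun_vec_smult fun_vec_add
    by (rule fun_vec_cong) (use r in \<open>auto simp: corona_ext_def corona_lift_def field_simps\<close>)
  have "?U *\<^sub>v fun_vec ?X (corona_ext g) = ?c \<cdot>\<^sub>v (?U *\<^sub>v ?F ?\<theta>) + (- ?c) \<cdot>\<^sub>v (?U *\<^sub>v ?F ?\<eta>)"
    unfolding ext
    by (simp add: mult_add_distrib_mat_vec[OF transition_mat_carrier]
        mult_mat_vec[OF transition_mat_carrier] fun_vec_carrier)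
  also have "\<dots> = ?p \<cdot>\<^sub>v fun_vec ?X (corona_ext g)"
    unfolding plus minus ext fun_vec_smult fun_vec_add by (simp add: algebra_simps)
  finally show ?thesis .
qed

lemma corona_swap_transition:
  assumes dist: "distinct (verts G)" and r: "r > 0"
    and fh: "\<And>v. v \<in> set (verts G) \<Longrightarrow> adj_op G f v = 2 * h v"
    and hf: "\<And>v. v \<in> set (verts G) \<Longrightarrow> adj_op G h v = 2 * f v"
    and m: "m = 4 * r\<^sup>2 - 1"
  shows "transition_mat (corona G (edgeless_graph m)) (pi / 2)
           *\<^sub>v fun_vec (corona G (edgeless_graph m)) (corona_ext f)
       = ((-1) ^ r * (- \<i>)) \<cdot>\<^sub>v fun_vec (corona G (edgeless_graph m)) (corona_ext h)"
proof -
  let ?X = "corona G (edgeless_graph m)"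
  let ?U = "transition_mat ?X (pi / 2)"
  let ?p = "(-1) ^ r * (- \<i>) :: complex"
  let ?E = "\<lambda>g. fun_vec ?X (corona_ext g)"
  \<comment> \<open>Eigenfunctions of \<open>G\<close> with eigenvalues \<open>2\<close> and \<open>-2\<close>.\<close>
  let ?a = "\<lambda>v. f v + h v" and ?b = "\<lambda>v. f v - h v"
  have "m + 1 = (2 * r)\<^sup>2" using r m by (simp add: power_mult_distrib)
  then have "of_nat (m + 1) = (of_nat ((2 * r)\<^sup>2) :: complex)" by (rule arg_cong)
  then have s: "1\<^sup>2 + of_nat m = (2 * of_nat r :: complex)\<^sup>2"
    "(- 1)\<^sup>2 + of_nat m = (2 * of_nat r :: complex)\<^sup>2"
    by (simp_all add: add.commute)
  have e: "exp (- \<i> * of_real (pi / 2) * 1) = - \<i>" "exp (- \<i> * of_real (pi / 2) * (- 1)) = \<i>"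
    by (simp_all add: complex_eq_iff Re_exp Im_exp)
  have "adj_op G ?a v = 2 * 1 * ?a v" if "v \<in> set (verts G)" for v
    using fh[OF that] hf[OF that] by (simp add: adj_op_def algebra_simps sum.distrib)
  from corona_eigenfunction_transition[OF dist r this s(1)]
  have a: "?U *\<^sub>v ?E ?a = ?p \<cdot>\<^sub>v ?E ?a" unfolding e by simp
  have "adj_op G ?b v = 2 * (- 1) * ?b v" if "v \<in> set (verts G)" for v
    using fh[OF that] hf[OF that] by (simp add: adj_op_def algebra_simps sum_subtractf)
  from corona_eigenfunction_transition[OF dist r this s(2)]
  have b: "?U *\<^sub>v ?E ?b = (- ?p) \<cdot>\<^sub>v ?E ?b" unfolding e by simp
  have f: "?E f = (1/2) \<cdot>\<^sub>v ?E ?a + (1/2) \<cdot>\<^sub>v ?E ?b"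
    unfolding fun_vec_smult fun_vec_add
    by (rule fun_vec_cong) (auto simp: corona_ext_def field_simps)
  have "?U *\<^sub>v ?E f = (1/2) \<cdot>\<^sub>v (?U *\<^sub>v ?E ?a) + (1/2) \<cdot>\<^sub>v (?U *\<^sub>v ?E ?b)"
    unfolding f
    by (simp add: mult_add_distrib_mat_vec[OF transition_mat_carrier]
        mult_mat_vec[OF transition_mat_carrier] fun_vec_carrier)
  also have "\<dots> = ?p \<cdot>\<^sub>v ?E h"
    unfolding a b fun_vec_smult fun_vec_add
    by (rule fun_vec_cong) (auto simp: corona_ext_def field_simps)
  finally show ?thesis .
qed

lemma corona_swap_amplitude:
  assumes dist: "distinct (verts G)" and r: "r > 0"
    and fh: "\<And>v. v \<in> set (verts G) \<Longrightarrow> adj_op G f v = 2 * h v"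
    and hf: "\<And>v. v \<in> set (verts G) \<Longrightarrow> adj_op G h v = 2 * f v"
    and m: "m = 4 * r\<^sup>2 - 1"
    and unit: "(\<Sum>v\<in>set (verts G). h v * h v) = 1"
  shows "cmod (fun_vec (corona G (edgeless_graph m)) (corona_ext h) \<bullet>
           (transition_mat (corona G (edgeless_graph m)) (pi / 2)
             *\<^sub>v fun_vec (corona G (edgeless_graph m)) (corona_ext f))) = 1"
proof -
  let ?X = "corona G (edgeless_graph m)"
  have distX: "distinct (verts ?X)"
    using dist by (intro distinct_verts_corona) (simp_all add: edgeless_graph_def)
  have "corona_ext h x * corona_ext h x = corona_ext (\<lambda>v. h v * h v) x" for x :: "'a \<times> nat option"
    by (auto simp: corona_ext_def split: prod.splits)
  then have "fun_vec ?X (corona_ext h) \<bullet> fun_vec ?X (corona_ext h) = 1"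
    using unit by (simp add: scalar_prod_fun_vec[OF distX] sum_corona_ext)
  moreover have "transition_mat ?X (pi / 2) *\<^sub>v fun_vec ?X (corona_ext f)
      = ((-1) ^ r * (- \<i>)) \<cdot>\<^sub>v fun_vec ?X (corona_ext h)"
    using dist r fh hf m by (rule corona_swap_transition)
  ultimately show ?thesis
    by (simp add: scalar_prod_smult_distrib[OF fun_vec_carrier fun_vec_carrier] norm_mult norm_power)
qed

section \<open>The digon and the \<open>4\<close>-cycle\<close>

lemma vertex_vec_corona:
  "vertex_vec (corona G H) (u, None)
    = fun_vec (corona G H) (corona_ext (\<lambda>v. if v = u then 1 else 0))"
  by (auto simp: vertex_vec_def fun_vec_def corona_ext_def split: prod.splits)

lemma vertex_set_vec_corona:
  "vertex_set_vec (corona G H) ((\<lambda>u. (u, None)) ` U)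
    = fun_vec (corona G H)
        (corona_ext (\<lambda>v. if v \<in> U then of_real (1 / sqrt (real (card U))) else 0))"
proof -
  have "card ((\<lambda>u. (u, None :: 'b option)) ` U) = card U"
    by (rule card_image) (auto simp: inj_on_def)
  then show ?thesis
    by (auto simp: vertex_set_vec_def fun_vec_def corona_ext_def split: prod.splits)
qed

lemma adj_op_cycle4:
  assumes "v \<in> set (verts (cycle_graph 4))"
  shows "adj_op (cycle_graph 4) (\<lambda>v. if v \<in> {0, 2} then c else 0) v
           = 2 * (if v \<in> {1, 3} then c else 0)"
    and "adj_op (cycle_graph 4) (\<lambda>v. if v \<in> {1, 3} then c else 0) v
           = 2 * (if v \<in> {0, 2} then c else 0)"
proof -
  have verts: "set (verts (cycle_graph 4)) = {0, 1, 2, 3}"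
    by (auto simp: cycle_graph_def)
  then have v: "v = 0 \<or> v = 1 \<or> v = 2 \<or> v = 3" using assms by auto
  have "adj_op (cycle_graph 4) f v = f ((v + 1) mod 4) + f ((v + 3) mod 4)" for f
  proof -
    have n: "Suc (Suc 0) = 2" "Suc (Suc (Suc 0)) = 3" by simp_all
    show ?thesis
      unfolding adj_op_def verts using v by (elim disjE) (simp_all add: cycle_graph_def n)
  qed
  then show "adj_op (cycle_graph 4) (\<lambda>v. if v \<in> {0, 2} then c else 0) v
           = 2 * (if v \<in> {1, 3} then c else 0)"
    and "adj_op (cycle_graph 4) (\<lambda>v. if v \<in> {1, 3} then c else 0) v
           = 2 * (if v \<in> {0, 2} then c else 0)"
    using v by (elim disjE; simp)+
qed

theorem theorem4p12:
  fixes r :: nat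
  assumes "r > 0"
  shows "(\<forall>u v. set (verts digon) = {u, v} \<longrightarrow>
            perfect_state_transfer (corona digon (edgeless_graph (4 * r\<^sup>2 - 1))) (pi / 2)
              (u, None) (v, None))
       \<and> (\<forall>u\<^sub>1 u\<^sub>2 v\<^sub>1 v\<^sub>2.
            antipodal_in_cycle 4 u\<^sub>1 u\<^sub>2 \<and> antipodal_in_cycle 4 v\<^sub>1 v\<^sub>2 \<and> {u\<^sub>1, u\<^sub>2} \<noteq> {v\<^sub>1, v\<^sub>2} \<longrightarrow>
            real_perfect_state_transfer (corona (cycle_graph 4) (edgeless_graph (4 * r\<^sup>2 - 1))) (pi / 2)
              {(u\<^sub>1, None), (u\<^sub>2, None)} {(v\<^sub>1, None), (v\<^sub>2, None)})"
proof (intro conjI allI impI)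
  fix u v assume "set (verts digon) = {u, v}"
  then have uv: "u = 0 \<and> v = 1 \<or> u = 1 \<and> v = 0"
    by (auto simp: digon_def doubleton_eq_iff)
  show "perfect_state_transfer (corona digon (edgeless_graph (4 * r\<^sup>2 - 1))) (pi / 2)
          (u, None) (v, None)"
    unfolding perfect_state_transfer_def vertex_vec_corona
    by (rule corona_swap_amplitude[OF _ assms])
      (use uv in \<open>auto simp: digon_def adj_op_def\<close>)
next
  fix u\<^sub>1 u\<^sub>2 v\<^sub>1 v\<^sub>2
  assume *: "antipodal_in_cycle 4 u\<^sub>1 u\<^sub>2 \<and> antipodal_in_cycle 4 v\<^sub>1 v\<^sub>2 \<and> {u\<^sub>1, u\<^sub>2} \<noteq> {v\<^sub>1, v\<^sub>2}"
  have verts: "set (verts (cycle_graph 4)) = {0, 1, 2, 3}"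
    by (auto simp: cycle_graph_def)
  have pair: "{a, b} = {0, 2} \<or> {a, b} = {1, 3}" if "antipodal_in_cycle 4 a b" for a b
    using that unfolding antipodal_in_cycle_def verts by auto
  have UV: "{u\<^sub>1, u\<^sub>2} = {0, 2} \<and> {v\<^sub>1, v\<^sub>2} = {1, 3} \<or> {u\<^sub>1, u\<^sub>2} = {1, 3} \<and> {v\<^sub>1, v\<^sub>2} = {0, 2}"
    using * pair[of u\<^sub>1 u\<^sub>2] pair[of v\<^sub>1 v\<^sub>2] by argo
  have half: "complex_of_real (1 / sqrt 2) * complex_of_real (1 / sqrt 2) = 1 / 2"
    unfolding of_real_mult[symmetric] by simp
  have image: "{(a, None), (b, None)} = (\<lambda>u. (u, None)) ` {a, b}" for a b :: nat
    by simp
  let ?X = "corona (cycle_graph 4) (edgeless_graph (4 * r\<^sup>2 - 1))"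
  let ?f = "\<lambda>U v. if v \<in> U then complex_of_real (1 / sqrt (real (card U))) else 0"
  have c: "card {0, 2 :: nat} = card {1, 3 :: nat}" by simp
  have dist: "distinct (verts (cycle_graph 4))" by (simp add: cycle_graph_def)
  show "real_perfect_state_transfer (corona (cycle_graph 4) (edgeless_graph (4 * r\<^sup>2 - 1))) (pi / 2)
          {(u\<^sub>1, None), (u\<^sub>2, None)} {(v\<^sub>1, None), (v\<^sub>2, None)}"
    unfolding real_perfect_state_transfer_def image vertex_set_vec_corona
    using UV
  proof (elim disjE conjE)
    assume U: "{u\<^sub>1, u\<^sub>2} = {0, 2}" and V: "{v\<^sub>1, v\<^sub>2} = {1, 3}"
    show "cmod (fun_vec ?X (corona_ext (?f {u\<^sub>1, u\<^sub>2})) \<bullet>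
        (transition_mat ?X (pi / 2) *\<^sub>v fun_vec ?X (corona_ext (?f {v\<^sub>1, v\<^sub>2})))) = 1"
      unfolding U V c
      by (rule corona_swap_amplitude[OF dist assms adj_op_cycle4(2) adj_op_cycle4(1)])
        (simp_all add: verts half del: of_real_divide)
  next
    assume U: "{u\<^sub>1, u\<^sub>2} = {1, 3}" and V: "{v\<^sub>1, v\<^sub>2} = {0, 2}"
    show "cmod (fun_vec ?X (corona_ext (?f {u\<^sub>1, u\<^sub>2})) \<bullet>
        (transition_mat ?X (pi / 2) *\<^sub>v fun_vec ?X (corona_ext (?f {v\<^sub>1, v\<^sub>2})))) = 1"
      unfolding U V c
      by (rule corona_swap_amplitude[OF dist assms adj_op_cycle4(1) adj_op_cycle4(2)])
        (simp_all add: verts half del: of_real_divide)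
  qed
qed

end
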